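(* For every prime $p\geq 5$ there exist a group $G$ of order $p^{12}$ and a non-degenerate class $[c]\in H^2(G,\mathbb{C}^* )$ which admits no normal Lagrangian.
   Context: $\mathbb{C}^*$ is regarded as a trivial $G$-module. A 2-cocycle $c\in Z^2(G,\mathbb{C}^* )$ is a map $c:G\times G\to\mathbb{C}^*$ with $c(g,h)c(gh,k)=c(g,hk)c(h,k)$ for all $g,h,k\in G$, and $[c]$ denotes its cohomology class. A subgroup $H$ of $G$ is isotropic with respect to $[c]$ if $\mathrm{res}^G_H[c]=0$ in $H^2(H,\mathbb{C}^* )$. The class $[c]$ (or the cocycle $c$) is non-degenerate if for every $x\in G$ with $x\neq e$ there is $g\in C_G(x)$ such that $c(x,g)\neq c(g,x)$; this depends only on the class $[c]$. A Lagrangian with respect to a non-degenerate class $[c]$ is a subgroup $H$ of $G$ which is isotropic with respect to $[c]$ and satisfies $|H|=\sqrt{|G|}$; a normal Lagrangian is a Lagrangian which is a normal subgroup of $G$. *)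

theory Defs
  imports Complex_Main "HOL-Computational_Algebra.Primes" "HOL-Algebra.Coset"
begin

text \<open>
  Low-degree group cohomology of a group with coefficients in the trivial module of nonzero
  complex numbers. Cochains are extensional functions, so that the cocycles form a group in the
  sense of HOL-Algebra; the group of a subgroup \<open>H\<close> of \<open>G\<close> is \<open>G\<lparr>carrier := H\<rparr>\<close>.
\<close>

definition Z2 :: "('a, 'b) monoid_scheme \<Rightarrow> ('a \<times> 'a \<Rightarrow> complex) monoid" where
  "Z2 G = \<lparr>carrier = {c \<in> carrier G \<times> carrier G \<rightarrow>\<^sub>E UNIV - {0}.
              \<forall>g\<in>carrier G. \<forall>h\<in>carrier G. \<forall>k\<in>carrier G.
                c (g, h) * c (g \<otimes>\<^bsub>G\<^esub> h, k) = c (g, h \<otimes>\<^bsub>G\<^esub> k) * c (h, k)},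
           monoid.mult = (\<lambda>c d. \<lambda>x\<in>carrier G \<times> carrier G. c x * d x),
           one = (\<lambda>x\<in>carrier G \<times> carrier G. 1)\<rparr>"

definition coboundary :: "('a, 'b) monoid_scheme \<Rightarrow> ('a \<Rightarrow> complex) \<Rightarrow> 'a \<times> 'a \<Rightarrow> complex" where
  "coboundary G f = (\<lambda>(g, h)\<in>carrier G \<times> carrier G. f g * f h / f (g \<otimes>\<^bsub>G\<^esub> h))"

definition B2 :: "('a, 'b) monoid_scheme \<Rightarrow> ('a \<times> 'a \<Rightarrow> complex) set" where
  "B2 G = coboundary G ` (carrier G \<rightarrow> UNIV - {0})"

definition H2 :: "('a, 'b) monoid_scheme \<Rightarrow> ('a \<times> 'a \<Rightarrow> complex) set monoid" where
  "H2 G = Z2 G Mod B2 G"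

definition cohomology_class ::
    "('a, 'b) monoid_scheme \<Rightarrow> ('a \<times> 'a \<Rightarrow> complex) \<Rightarrow> ('a \<times> 'a \<Rightarrow> complex) set" where
  "cohomology_class G c = B2 G #>\<^bsub>Z2 G\<^esub> c"

text \<open>
  The union ranges over all representatives of the class; they all contribute the same class
  on \<open>H\<close>, see \<open>res_class_cohomology_class\<close> below.
\<close>

definition res_class :: "('a, 'b) monoid_scheme \<Rightarrow> 'a set \<Rightarrow>
    ('a \<times> 'a \<Rightarrow> complex) set \<Rightarrow> ('a \<times> 'a \<Rightarrow> complex) set" where
  "res_class G H \<kappa> = (\<Union>c\<in>\<kappa>. cohomology_class (G\<lparr>carrier := H\<rparr>) (restrict c (H \<times> H)))"

definition isotropic ::
    "('a, 'b) monoid_scheme \<Rightarrow> ('a \<times> 'a \<Rightarrow> complex) set \<Rightarrow> 'a set \<Rightarrow> bool" where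
  "isotropic G \<kappa> H \<longleftrightarrow> subgroup H G \<and> res_class G H \<kappa> = \<one>\<^bsub>H2 (G\<lparr>carrier := H\<rparr>)\<^esub>"

definition centralizer :: "('a, 'b) monoid_scheme \<Rightarrow> 'a \<Rightarrow> 'a set" where
  "centralizer G x = {g \<in> carrier G. g \<otimes>\<^bsub>G\<^esub> x = x \<otimes>\<^bsub>G\<^esub> g}"

definition nondegenerate_cocycle ::
    "('a, 'b) monoid_scheme \<Rightarrow> ('a \<times> 'a \<Rightarrow> complex) \<Rightarrow> bool" where
  "nondegenerate_cocycle G c \<longleftrightarrow>
     (\<forall>x\<in>carrier G. x \<noteq> \<one>\<^bsub>G\<^esub> \<longrightarrow> (\<exists>g\<in>centralizer G x. c (x, g) \<noteq> c (g, x)))"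

text \<open>Independence of the representative is \<open>nondegenerate_cohomology_class\<close> below.\<close>

definition nondegenerate ::
    "('a, 'b) monoid_scheme \<Rightarrow> ('a \<times> 'a \<Rightarrow> complex) set \<Rightarrow> bool" where
  "nondegenerate G \<kappa> \<longleftrightarrow> (\<forall>c\<in>\<kappa>. nondegenerate_cocycle G c)"

text \<open>Meaningful for finite \<open>G\<close> only, since \<open>card\<close> and \<open>order\<close> are 0 on infinite sets.\<close>

definition lagrangian ::
    "('a, 'b) monoid_scheme \<Rightarrow> ('a \<times> 'a \<Rightarrow> complex) set \<Rightarrow> 'a set \<Rightarrow> bool" where
  "lagrangian G \<kappa> H \<longleftrightarrow> isotropic G \<kappa> H \<and> real (card H) = sqrt (real (order G))"

definition normal_lagrangian ::
    "('a, 'b) monoid_scheme \<Rightarrow> ('a \<times> 'a \<Rightarrow> complex) set \<Rightarrow> 'a set \<Rightarrow> bool" where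
  "normal_lagrangian G \<kappa> H \<longleftrightarrow> lagrangian G \<kappa> H \<and> H \<lhd> G"


lemma comm_group_Z2:
  fixes G (structure)
  assumes "group G" shows "comm_group (Z2 G)"
proof -
  interpret group G by fact
  show ?thesis
  proof (rule comm_groupI)
    fix c d assume cd: "c \<in> carrier (Z2 G)" "d \<in> carrier (Z2 G)"
    have "(c (g, h) * d (g, h)) * (c (g \<otimes> h, k) * d (g \<otimes> h, k))
        = (c (g, h \<otimes> k) * d (g, h \<otimes> k)) * (c (h, k) * d (h, k))"
      if g: "g \<in> carrier G" "h \<in> carrier G" "k \<in> carrier G" for g h k
    proof -
      have swap: "(x * y) * (z * t) = (x * z) * (y * t)" for x y z t :: complex
        by (simp only: mult_ac)
      have eq: "(c (g, h) * c (g \<otimes> h, k)) * (d (g, h) * d (g \<otimes> h, k))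
          = (c (g, h \<otimes> k) * c (h, k)) * (d (g, h \<otimes> k) * d (h, k))"
        using cd g by (simp add: Z2_def)
      show ?thesis by (rule trans[OF swap trans[OF eq swap]])
    qed
    with cd show "c \<otimes>\<^bsub>Z2 G\<^esub> d \<in> carrier (Z2 G)"
      by (simp add: Z2_def PiE_iff)
  next
    show "\<one>\<^bsub>Z2 G\<^esub> \<in> carrier (Z2 G)" by (auto simp: Z2_def)
  next
    fix c d e assume "c \<in> carrier (Z2 G)" "d \<in> carrier (Z2 G)" "e \<in> carrier (Z2 G)"
    then show "c \<otimes>\<^bsub>Z2 G\<^esub> d \<otimes>\<^bsub>Z2 G\<^esub> e = c \<otimes>\<^bsub>Z2 G\<^esub> (d \<otimes>\<^bsub>Z2 G\<^esub> e)"
      by (auto simp: Z2_def fun_eq_iff restrict_def)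
  next
    fix c d assume "c \<in> carrier (Z2 G)" "d \<in> carrier (Z2 G)"
    then show "c \<otimes>\<^bsub>Z2 G\<^esub> d = d \<otimes>\<^bsub>Z2 G\<^esub> c"
      by (auto simp: Z2_def fun_eq_iff restrict_def)
  next
    fix c assume "c \<in> carrier (Z2 G)"
    then show "\<one>\<^bsub>Z2 G\<^esub> \<otimes>\<^bsub>Z2 G\<^esub> c = c"
      by (auto simp: Z2_def fun_eq_iff restrict_def PiE_iff extensional_def)
  next
    fix c assume c: "c \<in> carrier (Z2 G)"
    let ?d = "\<lambda>x\<in>carrier G \<times> carrier G. inverse (c x)"
    from c have 1: "?d \<in> carrier (Z2 G)"
      by (simp add: Z2_def PiE_iff flip: inverse_mult_distrib)
    from c have 2: "?d \<otimes>\<^bsub>Z2 G\<^esub> c = \<one>\<^bsub>Z2 G\<^esub>"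
      by (auto simp: Z2_def fun_eq_iff restrict_def PiE_iff)
    from 1 2 show "\<exists>d\<in>carrier (Z2 G). d \<otimes>\<^bsub>Z2 G\<^esub> c = \<one>\<^bsub>Z2 G\<^esub>" by blast
  qed
qed

lemma subgroup_B2:
  fixes G (structure)
  assumes "group G" shows "subgroup (B2 G) (Z2 G)"
proof -
  interpret group G by fact
  interpret Z: comm_group "Z2 G" by (rule comm_group_Z2) fact
  have sub: "B2 G \<subseteq> carrier (Z2 G)"
  proof
    fix c assume "c \<in> B2 G"
    then obtain f where f: "\<And>x. x \<in> carrier G \<Longrightarrow> f x \<noteq> 0" and c: "c = coboundary G f"
      by (auto simp: B2_def Pi_iff)
    have canc: "x * y / a * (a * z / t) = x * b / t * (y * z / b)"
      if "a \<noteq> 0" "b \<noteq> 0" for x y z t a b :: complex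
      using that by simp
    have "f g * f h / f (g \<otimes> h) * (f (g \<otimes> h) * f k / f (g \<otimes> h \<otimes> k))
        = f g * f (h \<otimes> k) / f (g \<otimes> (h \<otimes> k)) * (f h * f k / f (h \<otimes> k))"
      if g: "g \<in> carrier G" "h \<in> carrier G" "k \<in> carrier G" for g h k
      unfolding m_assoc[OF g]
      by (rule canc[OF f[OF m_closed[OF g(1,2)]] f[OF m_closed[OF g(2,3)]]])
    moreover have "coboundary G f \<in> carrier G \<times> carrier G \<rightarrow>\<^sub>E UNIV - {0}"
      using f by (auto simp: coboundary_def)
    ultimately show "c \<in> carrier (Z2 G)"
      by (simp add: c Z2_def coboundary_def)
  qed
  show ?thesis
  proof (rule Z.subgroupI)
    show "B2 G \<subseteq> carrier (Z2 G)" by (rule sub)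
    have "(\<lambda>_. 1) \<in> carrier G \<rightarrow> UNIV - {0 :: complex}" by auto
    then show "B2 G \<noteq> {}" unfolding B2_def by blast
  next
    fix c assume "c \<in> B2 G"
    then obtain f where f: "f \<in> carrier G \<rightarrow> UNIV - {0}" and c: "c = coboundary G f"
      by (auto simp: B2_def)
    let ?f = "\<lambda>x. inverse (f x)"
    have f': "?f \<in> carrier G \<rightarrow> UNIV - {0}" using f by auto
    then have m: "coboundary G ?f \<in> B2 G" by (auto simp: B2_def)
    have "coboundary G ?f \<otimes>\<^bsub>Z2 G\<^esub> c = \<one>\<^bsub>Z2 G\<^esub>"
      using f by (auto simp: c coboundary_def Z2_def fun_eq_iff restrict_def Pi_iff field_simps)
    then have "inv\<^bsub>Z2 G\<^esub> c = coboundary G ?f"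
      using m sub \<open>c \<in> B2 G\<close> by (intro Z.inv_equality) auto
    then show "inv\<^bsub>Z2 G\<^esub> c \<in> B2 G" using m by simp
  next
    fix c d assume "c \<in> B2 G" "d \<in> B2 G"
    then obtain f1 f2 where f: "f1 \<in> carrier G \<rightarrow> UNIV - {0}" "f2 \<in> carrier G \<rightarrow> UNIV - {0}"
      and c: "c = coboundary G f1" "d = coboundary G f2"
      by (auto simp: B2_def)
    have "c \<otimes>\<^bsub>Z2 G\<^esub> d = coboundary G (\<lambda>x. f1 x * f2 x)"
      by (auto simp: c coboundary_def Z2_def fun_eq_iff restrict_def)
    moreover have "(\<lambda>x. f1 x * f2 x) \<in> carrier G \<rightarrow> UNIV - {0}" using f by auto
    ultimately show "c \<otimes>\<^bsub>Z2 G\<^esub> d \<in> B2 G" by (auto simp: B2_def)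
  qed
qed

lemma comm_group_H2:
  assumes "group G" shows "comm_group (H2 G)"
  unfolding H2_def
  using comm_group.abelian_FactGroup[OF comm_group_Z2 subgroup_B2] assms by blast

lemma carrier_H2: "carrier (H2 G) = cohomology_class G ` carrier (Z2 G)"
  by (auto simp: H2_def FactGroup_def RCOSETS_def cohomology_class_def)

lemma one_H2: "\<one>\<^bsub>H2 G\<^esub> = B2 G"
  by (simp add: H2_def FactGroup_def)

lemma restrict_cocycle:
  assumes "subgroup H G" "c \<in> carrier (Z2 G)"
  shows "restrict c (H \<times> H) \<in> carrier (Z2 (G\<lparr>carrier := H\<rparr>))"
proof -
  interpret subgroup H G by fact
  show ?thesis using assms(2) by (simp add: Z2_def PiE_iff)
qed

lemma mem_cohomology_class_iff:
  assumes "group G" "c \<in> carrier (Z2 G)"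
  shows "d \<in> cohomology_class G c \<longleftrightarrow>
    (\<exists>f \<in> carrier G \<rightarrow> UNIV - {0}. d = coboundary G f \<otimes>\<^bsub>Z2 G\<^esub> c)"
  by (auto simp: cohomology_class_def r_coset_def B2_def)

lemma res_class_cohomology_class:
  assumes "group G" "subgroup H G" "c \<in> carrier (Z2 G)"
  shows "res_class G H (cohomology_class G c)
           = cohomology_class (G\<lparr>carrier := H\<rparr>) (restrict c (H \<times> H))"
proof -
  let ?H = "G\<lparr>carrier := H\<rparr>"
  have gH: "group ?H" using assms by (simp add: subgroup.subgroup_is_group)
  interpret Z: comm_group "Z2 ?H" by (rule comm_group_Z2) fact
  interpret G: comm_group "Z2 G" by (rule comm_group_Z2) fact
  have HG: "x \<in> carrier G" if "x \<in> H" for x using assms that by (auto dest: subgroup.mem_carrier)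
  have mH: "x \<otimes>\<^bsub>G\<^esub> y \<in> H" if "x \<in> H" "y \<in> H" for x y using assms that by (auto intro: subgroup.m_closed)
  have rc: "restrict c (H \<times> H) \<in> carrier (Z2 ?H)" using assms by (intro restrict_cocycle)
  have *: "cohomology_class ?H (restrict d (H \<times> H)) = cohomology_class ?H (restrict c (H \<times> H))"
    if d: "d \<in> cohomology_class G c" for d
  proof -
    obtain f where f: "f \<in> carrier G \<rightarrow> UNIV - {0}" "d = coboundary G f \<otimes>\<^bsub>Z2 G\<^esub> c"
      using d mem_cohomology_class_iff[OF assms(1,3)] by auto
    have "restrict d (H \<times> H) = coboundary ?H f \<otimes>\<^bsub>Z2 ?H\<^esub> restrict c (H \<times> H)"
      by (auto simp: f Z2_def coboundary_def fun_eq_iff restrict_def HG)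
    moreover have "f \<in> carrier ?H \<rightarrow> UNIV - {0}" using f HG by auto
    ultimately have "restrict d (H \<times> H) \<in> cohomology_class ?H (restrict c (H \<times> H))"
      using mem_cohomology_class_iff[OF gH rc] by blast
    then show ?thesis
      unfolding cohomology_class_def
      using Z.repr_independence[OF _ rc subgroup_B2[OF gH]] by simp
  qed
  have self: "c \<in> cohomology_class G c"
    unfolding cohomology_class_def using G.rcos_self[OF assms(3) subgroup_B2[OF assms(1)]] .
  show ?thesis
  proof
    show "res_class G H (cohomology_class G c) \<subseteq> cohomology_class ?H (restrict c (H \<times> H))"
      unfolding res_class_def by (rule UN_least, subst *, assumption, rule subset_refl)
    show "cohomology_class ?H (restrict c (H \<times> H)) \<subseteq> res_class G H (cohomology_class G c)"
      unfolding res_class_def by (rule UN_upper) (rule self)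
  qed
qed

lemma nondegenerate_cohomology_class:
  assumes "group G" "c \<in> carrier (Z2 G)"
  shows "nondegenerate G (cohomology_class G c) \<longleftrightarrow> nondegenerate_cocycle G c"
proof -
  interpret G: comm_group "Z2 G" by (rule comm_group_Z2) fact
  have self: "c \<in> cohomology_class G c"
    unfolding cohomology_class_def using G.rcos_self[OF assms(2) subgroup_B2[OF assms(1)]] .
  have "nondegenerate_cocycle G d" if c: "nondegenerate_cocycle G c"
    and d: "d \<in> cohomology_class G c" for d
  proof -
    obtain f where f: "f \<in> carrier G \<rightarrow> UNIV - {0}" "d = coboundary G f \<otimes>\<^bsub>Z2 G\<^esub> c"
      using d mem_cohomology_class_iff[OF assms] by auto
    have "d (x, g) \<noteq> d (g, x)"
      if "x \<in> carrier G" "g \<in> centralizer G x" "c (x, g) \<noteq> c (g, x)" for x g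
    proof -
      have "f x \<noteq> 0" "f g \<noteq> 0" "f (x \<otimes>\<^bsub>G\<^esub> g) \<noteq> 0"
        using that f assms(1) by (auto simp: centralizer_def Pi_iff group.is_monoid monoid.m_closed)
      then show ?thesis
        using that by (auto simp: f Z2_def coboundary_def centralizer_def)
    qed
    then show ?thesis using c unfolding nondegenerate_cocycle_def by blast
  qed
  then show ?thesis unfolding nondegenerate_def using self by blast
qed

end

theory Submission
  imports Defs "HOL-Algebra.Product_Groups" "HOL-Algebra.Elementary_Groups"
    "HOL-Algebra.Weak_Morphisms" "HOL-Number_Theory.Cong"
begin

text \<open>
  The group is a semidirect product of \<open>Q = \<int>/p \<times> \<int>/p\<close> with a symplectic vector space \<open>M\<close> of
  dimension 10 over the field with \<open>p\<close> elements, on which \<open>Q\<close> acts by symplectic maps. A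
  bicharacter on \<open>M\<close> that \<open>Q\<close> preserves extends to a cocycle on the semidirect product, and its
  product with a nondegenerate bicharacter pulled back from \<open>Q\<close> is a nondegenerate cocycle
  (\<open>nondegenerate_cocycle\<close>).

  A normal Lagrangian \<open>H\<close> would have \<open>p\<^sup>6\<close> elements, more than an isotropic subgroup of \<open>M\<close> can
  have, so it would contain an element lying over some \<open>q \<noteq> \<one>\<close> of \<open>Q\<close>. By normality it would contain
  the commutators of that element with \<open>M\<close>, that is, the subspace \<open>(q - 1) M\<close>, which would
  therefore be isotropic
  (\<open>asymmetric_pair_in_normal_subgroup\<close>). For a symplectic map \<open>q\<close> this means \<open>(q - 1)\<^sup>2 = 0\<close>. So it
  suffices to let \<open>Q\<close> act such that \<open>(q - 1)\<^sup>2 \<noteq> 0\<close> for every \<open>q \<noteq> \<one>\<close>.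

  To this end take the 5-dimensional algebra \<open>W\<close> of polynomials in \<open>x, y\<close> modulo \<open>xy, x\<^sup>3, y\<^sup>3\<close>, let
  \<open>(i, j)\<close> act on it as multiplication by \<open>exp (2ix + 2jy)\<close>, and let \<open>M\<close> be the sum of \<open>W\<close> and
  its dual. The square of
  \<open>exp (2ix + 2jy) - 1\<close> is \<open>4i\<^sup>2x\<^sup>2 + 4j\<^sup>2y\<^sup>2\<close>, which is nonzero unless \<open>i = j = 0\<close>
  (\<open>shear_displacement_anisotropic\<close>).
\<close>

section \<open>Bicharacters on finite abelian groups\<close>

lemma sum_nontrivial_character:
  fixes \<chi> :: "'a \<Rightarrow> complex"
  assumes "group G"
    and hom: "\<And>x y. x \<in> carrier G \<Longrightarrow> y \<in> carrier G \<Longrightarrow> \<chi> (x \<otimes>\<^bsub>G\<^esub> y) = \<chi> x * \<chi> y"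
    and g: "g \<in> carrier G" "\<chi> g \<noteq> 1"
  shows "(\<Sum>x\<in>carrier G. \<chi> x) = 0"
proof -
  interpret group G by fact
  have "(\<Sum>x\<in>carrier G. \<chi> x) = (\<Sum>x\<in>(\<lambda>x. g \<otimes>\<^bsub>G\<^esub> x) ` carrier G. \<chi> x)"
    using surj_const_mult[OF g(1)] by simp
  also have "\<dots> = (\<Sum>x\<in>carrier G. \<chi> (g \<otimes>\<^bsub>G\<^esub> x))"
    using g(1) by (subst sum.reindex) (auto simp: inj_on_def)
  also have "\<dots> = \<chi> g * (\<Sum>x\<in>carrier G. \<chi> x)"
    using g(1) by (simp add: hom sum_distrib_left)
  finally show ?thesis using g(2) by simp
qed

text \<open>
  A bicharacter is a 2-cocycle on an abelian group; nondegeneracy refers to the alternating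
  bicharacter \<open>B x y / B y x\<close>, which plays the role of a symplectic form.
\<close>
locale nondegenerate_bicharacter = comm_group M for M (structure) +
  fixes B :: "'a \<Rightarrow> 'a \<Rightarrow> complex"
  assumes finite_carrier: "finite (carrier M)"
    and nonzero: "x \<in> carrier M \<Longrightarrow> y \<in> carrier M \<Longrightarrow> B x y \<noteq> 0"
    and mult_left: "x \<in> carrier M \<Longrightarrow> y \<in> carrier M \<Longrightarrow> z \<in> carrier M \<Longrightarrow>
      B (x \<otimes> y) z = B x z * B y z"
    and mult_right: "x \<in> carrier M \<Longrightarrow> y \<in> carrier M \<Longrightarrow> z \<in> carrier M \<Longrightarrow>
      B x (y \<otimes> z) = B x y * B x z"
    and radical_trivial: "x \<in> carrier M \<Longrightarrow> (\<And>y. y \<in> carrier M \<Longrightarrow> B x y = B y x) \<Longrightarrow> x = \<one>"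
begin

definition alt :: "'a \<Rightarrow> 'a \<Rightarrow> complex" where
  "alt x y = B x y / B y x"

definition perp :: "'a set \<Rightarrow> 'a set" where
  "perp A = {y \<in> carrier M. \<forall>x\<in>A. alt x y = 1}"

lemma one_left [simp]: "y \<in> carrier M \<Longrightarrow> B \<one> y = 1"
  using mult_left[of \<one> \<one> y] nonzero[of \<one> y] by simp

lemma one_right [simp]: "y \<in> carrier M \<Longrightarrow> B y \<one> = 1"
  using mult_right[of y \<one> \<one>] nonzero[of y \<one>] by simp

lemma inv_left: "x \<in> carrier M \<Longrightarrow> y \<in> carrier M \<Longrightarrow> B (inv x) y = inverse (B x y)"
  using mult_left[of x "inv x" y] nonzero[of x y] by (simp add: field_simps)

lemma inv_right: "x \<in> carrier M \<Longrightarrow> y \<in> carrier M \<Longrightarrow> B x (inv y) = inverse (B x y)"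
  using mult_right[of x y "inv y"] nonzero[of x y] by (simp add: field_simps)

lemma alt_eq_one_iff: "x \<in> carrier M \<Longrightarrow> y \<in> carrier M \<Longrightarrow> alt x y = 1 \<longleftrightarrow> B x y = B y x"
  using nonzero by (simp add: alt_def)

lemma alt_one_right [simp]: "x \<in> carrier M \<Longrightarrow> alt x \<one> = 1"
  by (simp add: alt_def)

lemma alt_commute_one: "x \<in> carrier M \<Longrightarrow> y \<in> carrier M \<Longrightarrow> alt x y = 1 \<longleftrightarrow> alt y x = 1"
  by (auto simp: alt_eq_one_iff)

lemma alt_mult_left:
  "x \<in> carrier M \<Longrightarrow> y \<in> carrier M \<Longrightarrow> z \<in> carrier M \<Longrightarrow> alt (x \<otimes> y) z = alt x z * alt y z"
  by (simp add: alt_def mult_left mult_right)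

lemma alt_mult_right:
  "x \<in> carrier M \<Longrightarrow> y \<in> carrier M \<Longrightarrow> z \<in> carrier M \<Longrightarrow> alt x (y \<otimes> z) = alt x y * alt x z"
  by (simp add: alt_def mult_left mult_right)

lemma alt_inv_right:
  "x \<in> carrier M \<Longrightarrow> y \<in> carrier M \<Longrightarrow> alt x (inv y) = inverse (alt x y)"
  by (simp add: alt_def inv_left inv_right field_simps)

lemma alt_inv_left:
  "x \<in> carrier M \<Longrightarrow> y \<in> carrier M \<Longrightarrow> alt (inv x) y = inverse (alt x y)"
  by (simp add: alt_def inv_left inv_right field_simps)

lemma subgroup_perp:
  assumes "A \<subseteq> carrier M" shows "subgroup (perp A) M"
  using assms
  by (intro subgroupI)
    (auto simp: perp_def alt_mult_right alt_inv_right subset_iff intro!: exI[of _ \<one>])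

text \<open>
  Both sides count \<open>\<Sum>m\<in>M. \<Sum>a\<in>A. alt a m\<close>: for fixed \<open>m\<close> the inner sum is a character sum over
  \<open>A\<close>, which vanishes unless \<open>m\<close> lies in the complement; for fixed \<open>a\<close> the sum over \<open>m\<close> vanishes
  unless \<open>a = \<one>\<close>, by nondegeneracy.
\<close>
lemma card_perp:
  assumes "subgroup A M" shows "card A * card (perp A) = order M"
proof -
  interpret A: subgroup A M by fact
  have fA: "finite A" using finite_carrier A.subset finite_subset by blast
  have gA: "group (M\<lparr>carrier := A\<rparr>)" using assms by (rule subgroup_imp_group)
  have inner: "(\<Sum>a\<in>A. alt a m) = (if m \<in> perp A then of_nat (card A) else 0)"
    if m: "m \<in> carrier M" for m
  proof (cases "m \<in> perp A")
    case True
    then show ?thesis by (simp add: perp_def)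
  next
    case False
    then obtain a where "a \<in> A" "alt a m \<noteq> 1" using m by (auto simp: perp_def)
    then have "(\<Sum>a\<in>A. alt a m) = 0"
      using sum_nontrivial_character[OF gA, of "\<lambda>a. alt a m" a] m by (simp add: alt_mult_left)
    then show ?thesis using False by simp
  qed
  have outer: "(\<Sum>m\<in>carrier M. alt a m) = (if a = \<one> then of_nat (order M) else 0)"
    if a: "a \<in> carrier M" for a
  proof (cases "a = \<one>")
    case True
    then show ?thesis by (simp add: alt_def order_def)
  next
    case False
    then obtain m where "m \<in> carrier M" "alt a m \<noteq> 1"
      using radical_trivial[OF a] alt_eq_one_iff[OF a] by blast
    then have "(\<Sum>m\<in>carrier M. alt a m) = 0"
      using sum_nontrivial_character[OF is_group, of "alt a" m] a by (simp add: alt_mult_right)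
    then show ?thesis using False by simp
  qed
  have "perp A \<subseteq> carrier M" by (auto simp: perp_def)
  then have "(\<Sum>m\<in>carrier M. \<Sum>a\<in>A. alt a m) = of_nat (card A * card (perp A))"
    using finite_carrier by (simp add: inner sum.If_cases Int_absorb1)
  moreover have "(\<Sum>a\<in>A. \<Sum>m\<in>carrier M. alt a m) = of_nat (order M)"
    using fA by (simp add: outer)
  moreover have "(\<Sum>m\<in>carrier M. \<Sum>a\<in>A. alt a m) = (\<Sum>a\<in>A. \<Sum>m\<in>carrier M. alt a m)"
    by (rule sum.swap)
  ultimately have "complex_of_nat (card A * card (perp A)) = of_nat (order M)" by metis
  then show ?thesis by (simp only: of_nat_eq_iff)
qed

lemma perp_perp:
  assumes "subgroup A M" shows "perp (perp A) = A"
proof -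
  interpret A: subgroup A M by fact
  have sp: "subgroup (perp A) M" using A.subset by (rule subgroup_perp)
  have sub: "A \<subseteq> perp (perp A)"
    using A.subset by (auto simp: perp_def alt_commute_one)
  have fin: "finite (perp (perp A))"
    using finite_carrier by (rule rev_finite_subset) (auto simp: perp_def)
  have "order M > 0" using finite_carrier by (simp add: order_gt_0_iff_finite)
  then have "card (perp (perp A)) = card A"
    using card_perp[OF assms] card_perp[OF sp]
    by (metis mult.commute mult_left_cancel mult_is_0 not_less0)
  then show ?thesis using card_subset_eq[OF fin sub] by simp
qed

lemma card_isotropic_le:
  assumes "subgroup A M" "\<And>x y. x \<in> A \<Longrightarrow> y \<in> A \<Longrightarrow> B x y = B y x"
  shows "(card A)\<^sup>2 \<le> order M"
proof -
  interpret A: subgroup A M by fact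
  have "A \<subseteq> perp A" using assms(2) by (auto simp: perp_def alt_eq_one_iff)
  moreover have "finite (perp A)"
    using finite_carrier by (rule rev_finite_subset) (auto simp: perp_def)
  ultimately have "card A \<le> card (perp A)" by (rule card_mono[rotated])
  then have "card A * card A \<le> card A * card (perp A)" by (rule mult_le_mono2)
  then show ?thesis by (simp only: power2_eq_square card_perp[OF assms(1)])
qed

end


section \<open>Symplectic actions and their semidirect products\<close>

locale symplectic_action =
  Q: nondegenerate_bicharacter Q \<beta> + M: nondegenerate_bicharacter M B
  for Q :: "('q, 'c) monoid_scheme" and \<beta> and M :: "('m, 'd) monoid_scheme" and B +
  fixes act :: "'q \<Rightarrow> 'm \<Rightarrow> 'm"
  assumes act_closed [simp]: "q \<in> carrier Q \<Longrightarrow> x \<in> carrier M \<Longrightarrow> act q x \<in> carrier M"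
    and act_mult: "q \<in> carrier Q \<Longrightarrow> x \<in> carrier M \<Longrightarrow> y \<in> carrier M \<Longrightarrow>
      act q (x \<otimes>\<^bsub>M\<^esub> y) = act q x \<otimes>\<^bsub>M\<^esub> act q y"
    and act_act: "q \<in> carrier Q \<Longrightarrow> r \<in> carrier Q \<Longrightarrow> x \<in> carrier M \<Longrightarrow>
      act q (act r x) = act (q \<otimes>\<^bsub>Q\<^esub> r) x"
    and act_one [simp]: "x \<in> carrier M \<Longrightarrow> act \<one>\<^bsub>Q\<^esub> x = x"
    and invariant: "q \<in> carrier Q \<Longrightarrow> x \<in> carrier M \<Longrightarrow> y \<in> carrier M \<Longrightarrow>
      B (act q x) (act q y) = B x y"
begin

definition semidirect :: "('q \<times> 'm) monoid" where
  "semidirect = \<lparr>carrier = carrier Q \<times> carrier M,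
     monoid.mult = (\<lambda>(q, x) (r, y). (q \<otimes>\<^bsub>Q\<^esub> r, x \<otimes>\<^bsub>M\<^esub> act q y)),
     one = (\<one>\<^bsub>Q\<^esub>, \<one>\<^bsub>M\<^esub>)\<rparr>"

definition cocycle :: "('q \<times> 'm) \<times> ('q \<times> 'm) \<Rightarrow> complex" where
  "cocycle = (\<lambda>((q, x), (r, y)) \<in> (carrier Q \<times> carrier M) \<times> (carrier Q \<times> carrier M).
     \<beta> q r * B x (act q y))"

text \<open>The image of \<open>q - 1\<close>, in additive language.\<close>
definition displacement :: "'q \<Rightarrow> 'm \<Rightarrow> 'm" where
  "displacement q x = act q x \<otimes>\<^bsub>M\<^esub> inv\<^bsub>M\<^esub> x"

lemma displacement_closed [simp]:
  "q \<in> carrier Q \<Longrightarrow> x \<in> carrier M \<Longrightarrow> displacement q x \<in> carrier M"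
  by (simp add: displacement_def)

lemma displacement_mult:
  "q \<in> carrier Q \<Longrightarrow> x \<in> carrier M \<Longrightarrow> displacement q x \<otimes>\<^bsub>M\<^esub> x = act q x"
  by (simp add: displacement_def M.m_assoc)

lemma act_id [simp]: "q \<in> carrier Q \<Longrightarrow> act q \<one>\<^bsub>M\<^esub> = \<one>\<^bsub>M\<^esub>"
  using act_mult[of q "\<one>\<^bsub>M\<^esub>" "\<one>\<^bsub>M\<^esub>"] by simp

lemma act_inv:
  assumes "q \<in> carrier Q" "x \<in> carrier M" shows "act q (inv\<^bsub>M\<^esub> x) = inv\<^bsub>M\<^esub> act q x"
  using assms act_mult[of q "inv\<^bsub>M\<^esub> x" x] by (intro M.inv_equality[symmetric]) auto

lemma carrier_semidirect [simp]: "carrier semidirect = carrier Q \<times> carrier M"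
  by (simp add: semidirect_def)

lemma one_semidirect [simp]: "\<one>\<^bsub>semidirect\<^esub> = (\<one>\<^bsub>Q\<^esub>, \<one>\<^bsub>M\<^esub>)"
  by (simp add: semidirect_def)

lemma mult_semidirect [simp]:
  "(q, x) \<otimes>\<^bsub>semidirect\<^esub> (r, y) = (q \<otimes>\<^bsub>Q\<^esub> r, x \<otimes>\<^bsub>M\<^esub> act q y)"
  by (simp add: semidirect_def)

lemma B_displacement:
  assumes "q \<in> carrier Q" "x \<in> carrier M" "y \<in> carrier M"
  shows "B (displacement q x) (displacement q y) = (B x y)\<^sup>2 / (B (act q x) y * B x (act q y))"
  using assms M.nonzero
  by (simp add: displacement_def M.mult_left M.mult_right M.inv_left M.inv_right invariant
      field_simps power2_eq_square)

lemma group_semidirect: "group semidirect"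
proof (rule groupI)
  fix g h k assume "g \<in> carrier semidirect" "h \<in> carrier semidirect" "k \<in> carrier semidirect"
  then show "g \<otimes>\<^bsub>semidirect\<^esub> h \<otimes>\<^bsub>semidirect\<^esub> k = g \<otimes>\<^bsub>semidirect\<^esub> (h \<otimes>\<^bsub>semidirect\<^esub> k)"
    by (auto simp: act_mult act_act Q.m_assoc M.m_assoc)
next
  fix g assume "g \<in> carrier semidirect"
  then obtain q x where g: "g = (q, x)" "q \<in> carrier Q" "x \<in> carrier M" by auto
  then show "\<exists>h\<in>carrier semidirect. h \<otimes>\<^bsub>semidirect\<^esub> g = \<one>\<^bsub>semidirect\<^esub>"
    by (intro bexI[of _ "(inv\<^bsub>Q\<^esub> q, inv\<^bsub>M\<^esub> act (inv\<^bsub>Q\<^esub> q) x)"]) auto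
qed auto

lemma cocycle_apply:
  "q \<in> carrier Q \<Longrightarrow> r \<in> carrier Q \<Longrightarrow> x \<in> carrier M \<Longrightarrow> y \<in> carrier M \<Longrightarrow>
    cocycle ((q, x), (r, y)) = \<beta> q r * B x (act q y)"
  by (simp add: cocycle_def)

text \<open>Invariance of \<open>B\<close> is what makes the cocycle \<open>B\<close> on \<open>M\<close> extend to the semidirect product.\<close>
lemma cocycle_in_Z2: "cocycle \<in> carrier (Z2 semidirect)"
proof -
  have "cocycle \<in> carrier semidirect \<times> carrier semidirect \<rightarrow>\<^sub>E UNIV - {0}"
    by (auto simp: cocycle_def Q.nonzero M.nonzero)
  moreover have "cocycle ((q, x), (r, y)) * cocycle ((q, x) \<otimes>\<^bsub>semidirect\<^esub> (r, y), (s, z)) =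
      cocycle ((q, x), (r, y) \<otimes>\<^bsub>semidirect\<^esub> (s, z)) * cocycle ((r, y), (s, z))"
    if "q \<in> carrier Q" "x \<in> carrier M" "r \<in> carrier Q" "y \<in> carrier M"
      "s \<in> carrier Q" "z \<in> carrier M" for q x r y s z
  proof -
    have "B (act q y) (act (q \<otimes>\<^bsub>Q\<^esub> r) z) = B y (act r z)"
      using that invariant[of q y "act r z"] by (simp add: act_act)
    then show ?thesis
      using that by (simp add: cocycle_apply act_mult act_act Q.mult_left Q.mult_right
          M.mult_left M.mult_right)
  qed
  ultimately show ?thesis by (auto simp: Z2_def simp del: mult_semidirect)
qed

lemma subgroup_displacement:
  assumes q: "q \<in> carrier Q" shows "subgroup (displacement q ` carrier M) M"
proof (rule M.subgroupI)
  show "displacement q ` carrier M \<subseteq> carrier M" using q by auto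
next
  show "displacement q ` carrier M \<noteq> {}" by auto
next
  fix a assume "a \<in> displacement q ` carrier M"
  then obtain x where x: "x \<in> carrier M" "a = displacement q x" by auto
  then have "inv\<^bsub>M\<^esub> a = displacement q (inv\<^bsub>M\<^esub> x)"
    using q by (simp add: displacement_def act_inv M.inv_mult_group M.m_comm)
  then show "inv\<^bsub>M\<^esub> a \<in> displacement q ` carrier M" using x by blast
next
  fix a b assume "a \<in> displacement q ` carrier M" "b \<in> displacement q ` carrier M"
  then obtain x y where x: "x \<in> carrier M" "a = displacement q x"
    and y: "y \<in> carrier M" "b = displacement q y" by auto
  then have "a \<otimes>\<^bsub>M\<^esub> b = displacement q (x \<otimes>\<^bsub>M\<^esub> y)"
    using q by (simp add: displacement_def act_mult M.inv_mult_group M.m_ac)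
  then show "a \<otimes>\<^bsub>M\<^esub> b \<in> displacement q ` carrier M" using x y by blast
qed

text \<open>
  Additively: \<open>\<omega> (q z - z, x) = 0\<close> for all \<open>z\<close> means \<open>\<omega> (q z, x) = \<omega> (z, x) = \<omega> (q z, q x)\<close>, and \<open>q z\<close>
  is arbitrary.
\<close>
lemma fixed_if_perp_displacement:
  assumes q: "q \<in> carrier Q" and x: "x \<in> M.perp (displacement q ` carrier M)"
  shows "act q x = x"
proof -
  have xM: "x \<in> carrier M" using x by (simp add: M.perp_def)
  have alt_act: "M.alt (act q u) (act q v) = M.alt u v" if "u \<in> carrier M" "v \<in> carrier M" for u v
    using that q by (simp add: M.alt_def invariant)
  have "M.alt y (displacement q x) = 1" if y: "y \<in> carrier M" for y
  proof -
    define z where "z = act (inv\<^bsub>Q\<^esub> q) y"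
    have z: "z \<in> carrier M" "act q z = y" using y q by (auto simp: z_def act_act)
    have "M.alt (displacement q z) x = 1" using x z(1) by (auto simp: M.perp_def)
    then have "M.alt y x * inverse (M.alt z x) = 1"
      using z y xM by (simp add: displacement_def M.alt_mult_left M.alt_inv_left)
    moreover have "M.alt y (act q x) = M.alt z x" using alt_act[OF z(1) xM] z(2) by simp
    ultimately show ?thesis
      using xM y q by (simp add: displacement_def M.alt_mult_right M.alt_inv_right field_simps)
  qed
  then have "displacement q x = \<one>\<^bsub>M\<^esub>"
    using M.radical_trivial[of "displacement q x"] q xM by (simp add: M.alt_eq_one_iff)
  then show ?thesis using displacement_mult[OF q xM] xM by simp
qed

text \<open>
  Suppose that \<open>(q, x)\<close> commutes symmetrically with its whole centralizer. The fixed vectors of \<open>q\<close>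
  lie in that centralizer, so \<open>x\<close> is orthogonal to them, and then \<open>x\<close> lies in the image of \<open>q - 1\<close>,
  because this image is its own double complement. So \<open>(q, x)\<close> is conjugate to \<open>(q, \<one>)\<close>, whose
  centralizer contains \<open>Q\<close>; nondegeneracy of \<open>\<beta>\<close> gives \<open>q = \<one>\<close>, and \<open>x = \<one>\<close> follows.
\<close>
lemma nondegenerate_cocycle: "nondegenerate_cocycle semidirect cocycle"
  unfolding nondegenerate_cocycle_def
proof (intro ballI impI, rule ccontr)
  fix g assume "g \<in> carrier semidirect" and g1: "g \<noteq> \<one>\<^bsub>semidirect\<^esub>"
    and contra: "\<not> (\<exists>h\<in>centralizer semidirect g. cocycle (g, h) \<noteq> cocycle (h, g))"
  then obtain q x where g: "g = (q, x)" and q: "q \<in> carrier Q" and x: "x \<in> carrier M" by auto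
  have sym: "cocycle ((q, x), (r, y)) = cocycle ((r, y), (q, x))"
    if "r \<in> carrier Q" "y \<in> carrier M" "y \<otimes>\<^bsub>M\<^esub> act r x = x \<otimes>\<^bsub>M\<^esub> act q y" for r y
    using contra that q x by (auto simp: g centralizer_def Q.m_comm)
  have "M.alt y x = 1" if y: "y \<in> M.perp (displacement q ` carrier M)" for y
  proof -
    have yM: "y \<in> carrier M" using y by (simp add: M.perp_def)
    have "act q y = y" using q y by (rule fixed_if_perp_displacement)
    then show ?thesis
      using sym[of "\<one>\<^bsub>Q\<^esub>" y] yM q x by (simp add: cocycle_apply M.m_comm M.alt_eq_one_iff)
  qed
  then have "x \<in> M.perp (M.perp (displacement q ` carrier M))"
    using x by (simp add: M.perp_def)
  then obtain z where z: "z \<in> carrier M" and xz: "x = displacement q z"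
    using M.perp_perp[OF subgroup_displacement[OF q]] by auto
  \<comment> \<open>\<open>(r, displacement r z)\<close> is the conjugate of \<open>(r, \<one>)\<close> by \<open>(\<one>, inv z)\<close>, and so is \<open>(q, x)\<close> for \<open>r = q\<close>.\<close>
  have "\<beta> q r = \<beta> r q" if r: "r \<in> carrier Q" for r
  proof -
    define a b c where "a = act q z" and "b = act r z" and "c = act (q \<otimes>\<^bsub>Q\<^esub> r) z"
    have abc: "a \<in> carrier M" "b \<in> carrier M" "c \<in> carrier M"
      using q r z by (auto simp: a_def b_def c_def)
    have x_eq: "x = a \<otimes>\<^bsub>M\<^esub> inv\<^bsub>M\<^esub> z" and d_eq: "displacement r z = b \<otimes>\<^bsub>M\<^esub> inv\<^bsub>M\<^esub> z"
      by (auto simp: xz displacement_def a_def b_def)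
    have rx: "act r x = c \<otimes>\<^bsub>M\<^esub> inv\<^bsub>M\<^esub> b"
      using q r z abc by (simp add: x_eq act_mult act_inv) (simp add: a_def b_def c_def act_act Q.m_comm)
    have qd: "act q (displacement r z) = c \<otimes>\<^bsub>M\<^esub> inv\<^bsub>M\<^esub> a"
      using q r z abc by (simp add: d_eq act_mult act_inv) (simp add: a_def b_def c_def act_act)
    have canc: "(u \<otimes>\<^bsub>M\<^esub> inv\<^bsub>M\<^esub> z) \<otimes>\<^bsub>M\<^esub> (c \<otimes>\<^bsub>M\<^esub> inv\<^bsub>M\<^esub> u) = c \<otimes>\<^bsub>M\<^esub> inv\<^bsub>M\<^esub> z"
      if "u \<in> carrier M" for u
    proof -
      have "(u \<otimes>\<^bsub>M\<^esub> inv\<^bsub>M\<^esub> z) \<otimes>\<^bsub>M\<^esub> (c \<otimes>\<^bsub>M\<^esub> inv\<^bsub>M\<^esub> u) =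
          (u \<otimes>\<^bsub>M\<^esub> inv\<^bsub>M\<^esub> u) \<otimes>\<^bsub>M\<^esub> (c \<otimes>\<^bsub>M\<^esub> inv\<^bsub>M\<^esub> z)"
        using that abc z by (simp only: M.m_ac M.m_closed M.inv_closed)
      then show ?thesis using that abc z by simp
    qed
    have "displacement r z \<otimes>\<^bsub>M\<^esub> act r x = x \<otimes>\<^bsub>M\<^esub> act q (displacement r z)"
      unfolding rx qd unfolding x_eq d_eq by (simp add: canc abc)
    then have "cocycle ((q, x), (r, displacement r z)) = cocycle ((r, displacement r z), (q, x))"
      using sym[OF r, of "displacement r z"] z r by simp
    moreover have "B x (act q (displacement r z)) = B (displacement r z) (act r x)"
    proof -
      have "B a c = B z b" "B b c = B z a" "B a a = B z z" "B b b = B z z"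
        using q r z invariant[of q z b] invariant[of r z a]
        by (simp_all add: a_def b_def c_def act_act invariant Q.m_comm)
      then show ?thesis
        unfolding rx qd unfolding x_eq d_eq
        using abc z by (simp add: M.mult_left M.mult_right M.inv_left M.inv_right)
    qed
    ultimately show ?thesis
      using q r x z by (simp add: cocycle_apply M.nonzero)
  qed
  then have q1: "q = \<one>\<^bsub>Q\<^esub>" using Q.radical_trivial[OF q] by simp
  then have "x = \<one>\<^bsub>M\<^esub>" using xz z by (simp add: displacement_def)
  then show False using g g1 q1 by simp
qed

text \<open>
  An element \<open>(q, x)\<close> of \<open>H\<close> with \<open>q \<noteq> \<one>\<close> drags the whole image of \<open>q - 1\<close> into \<open>H\<close>: these are its
  commutators with \<open>M\<close>. That image lies in the abelian group \<open>M\<close>, so if it is not isotropic, it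
  contains a pair as required. Otherwise \<open>H\<close> lies in \<open>M\<close>, where a subgroup with more than
  \<open>\<surd>|M|\<close> elements is never isotropic.
\<close>
lemma asymmetric_pair_in_normal_subgroup:
  assumes "order Q > 1"
    and anis: "\<And>q. q \<in> carrier Q \<Longrightarrow> q \<noteq> \<one>\<^bsub>Q\<^esub> \<Longrightarrow> \<exists>x\<in>carrier M. \<exists>y\<in>carrier M.
      B (displacement q x) (displacement q y) \<noteq> B (displacement q y) (displacement q x)"
    and H: "H \<lhd> semidirect" and card: "(card H)\<^sup>2 = order semidirect"
  shows "\<exists>h\<in>H. \<exists>k\<in>H. h \<otimes>\<^bsub>semidirect\<^esub> k = k \<otimes>\<^bsub>semidirect\<^esub> h \<and> cocycle (h, k) \<noteq> cocycle (k, h)"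
proof (rule ccontr)
  assume contra: "\<not> ?thesis"
  interpret S: group semidirect by (rule group_semidirect)
  interpret H: normal H semidirect by (rule H)
  have sym: "B x y = B y x" if "(\<one>\<^bsub>Q\<^esub>, x) \<in> H" "(\<one>\<^bsub>Q\<^esub>, y) \<in> H" for x y
  proof -
    have "x \<in> carrier M" "y \<in> carrier M" using that H.subset by auto
    then show ?thesis using contra that by (force simp: cocycle_apply M.m_comm)
  qed
  have q1: "q = \<one>\<^bsub>Q\<^esub>" if h: "(q, x) \<in> H" for q x
  proof (rule ccontr)
    assume "q \<noteq> \<one>\<^bsub>Q\<^esub>"
    have qx: "q \<in> carrier Q" "x \<in> carrier M" using h H.subset by auto
    have "(\<one>\<^bsub>Q\<^esub>, displacement q y) \<in> H" if y: "y \<in> carrier M" for y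
    proof -
      let ?h = "(q, x)" and ?y = "(\<one>\<^bsub>Q\<^esub>, y)" and ?d = "(\<one>\<^bsub>Q\<^esub>, displacement q y)"
      have c: "?h \<in> carrier semidirect" "?y \<in> carrier semidirect" "?d \<in> carrier semidirect"
        using qx y by auto
      have "displacement q y \<otimes>\<^bsub>M\<^esub> (y \<otimes>\<^bsub>M\<^esub> x) = x \<otimes>\<^bsub>M\<^esub> act q y"
        using qx y M.m_comm[of x "act q y"] by (simp add: displacement_mult flip: M.m_assoc)
      then have "?d \<otimes>\<^bsub>semidirect\<^esub> (?y \<otimes>\<^bsub>semidirect\<^esub> ?h) = ?h \<otimes>\<^bsub>semidirect\<^esub> ?y"
        using qx y by simp
      then have "?d = ?h \<otimes>\<^bsub>semidirect\<^esub> ?y \<otimes>\<^bsub>semidirect\<^esub> inv\<^bsub>semidirect\<^esub> (?y \<otimes>\<^bsub>semidirect\<^esub> ?h)"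
        using c by (metis S.inv_solve_right S.m_closed)
      also have "\<dots> = ?h \<otimes>\<^bsub>semidirect\<^esub> (?y \<otimes>\<^bsub>semidirect\<^esub> inv\<^bsub>semidirect\<^esub> ?h \<otimes>\<^bsub>semidirect\<^esub> inv\<^bsub>semidirect\<^esub> ?y)"
        using c by (simp only: S.inv_mult_group S.m_assoc S.m_closed S.inv_closed)
      also have "\<dots> \<in> H" using h c by (intro H.m_closed H.inv_op_closed2 H.m_inv_closed)
      finally show ?thesis .
    qed
    then show False using anis[OF qx(1) \<open>q \<noteq> \<one>\<^bsub>Q\<^esub>\<close>] sym by blast
  qed
  define A where "A = {x \<in> carrier M. (\<one>\<^bsub>Q\<^esub>, x) \<in> H}"
  have HA: "H = (\<lambda>x. (\<one>\<^bsub>Q\<^esub>, x)) ` A"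
    using q1 H.subset by (auto simp: A_def)
  have "subgroup A M"
  proof (rule M.subgroupI)
    show "A \<noteq> {}" using H.one_closed by (auto simp: A_def)
  next
    fix a assume a: "a \<in> A"
    then have "(\<one>\<^bsub>Q\<^esub>, inv\<^bsub>M\<^esub> a) = inv\<^bsub>semidirect\<^esub> (\<one>\<^bsub>Q\<^esub>, a)"
      by (intro S.inv_equality[symmetric]) (auto simp: A_def)
    then show "inv\<^bsub>M\<^esub> a \<in> A" using a by (auto simp: A_def)
  next
    fix a b assume "a \<in> A" "b \<in> A"
    then show "a \<otimes>\<^bsub>M\<^esub> b \<in> A" using H.m_closed[of "(\<one>\<^bsub>Q\<^esub>, a)" "(\<one>\<^bsub>Q\<^esub>, b)"] by (simp add: A_def)
  qed (auto simp: A_def)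
  then have "(card A)\<^sup>2 \<le> order M"
    using sym by (intro M.card_isotropic_le) (auto simp: A_def)
  moreover have "card H = card A" unfolding HA by (simp add: card_image inj_on_def)
  moreover have "order semidirect = order Q * order M"
    by (simp add: order_def card_cartesian_product)
  moreover have "order M > 0" using M.finite_carrier by (simp add: M.order_gt_0_iff_finite)
  ultimately show False using assms(1) card by simp
qed

end


section \<open>From commuting pairs to cohomology classes\<close>

text \<open>A coboundary is symmetric on commuting pairs.\<close>
lemma isotropic_cohomology_class_commute:
  assumes "group G" "c \<in> carrier (Z2 G)" "isotropic G (cohomology_class G c) H"
    and hk: "h \<in> H" "k \<in> H" "h \<otimes>\<^bsub>G\<^esub> k = k \<otimes>\<^bsub>G\<^esub> h"
  shows "c (h, k) = c (k, h)"
proof -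
  let ?H = "G\<lparr>carrier := H\<rparr>"
  have H: "subgroup H G" using assms(3) by (simp add: isotropic_def)
  then have gH: "group ?H" using assms(1) by (simp add: subgroup.subgroup_is_group)
  interpret Z: comm_group "Z2 ?H" by (rule comm_group_Z2) (rule gH)
  have rc: "restrict c (H \<times> H) \<in> carrier (Z2 ?H)" using H assms(2) by (rule restrict_cocycle)
  have "restrict c (H \<times> H) \<in> cohomology_class ?H (restrict c (H \<times> H))"
    unfolding cohomology_class_def using Z.rcos_self[OF rc subgroup_B2[OF gH]] .
  also have "\<dots> = B2 ?H"
    using assms(3) res_class_cohomology_class[OF assms(1) H assms(2)]
    by (simp add: isotropic_def one_H2)
  finally have "restrict c (H \<times> H) \<in> B2 ?H" .
  then obtain f where "restrict c (H \<times> H) = coboundary ?H f" unfolding B2_def by (rule imageE)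
  then have "c (x, y) = f x * f y / f (x \<otimes>\<^bsub>G\<^esub> y)" if "x \<in> H" "y \<in> H" for x y
    using that by (auto simp: coboundary_def fun_eq_iff restrict_def split: if_splits)
  then show ?thesis using hk by simp
qed

text \<open>
  The criterion on \<open>G\<close> mentions elements only, so it passes along any bijection of the carrier onto
  a set of natural numbers; on the copy it is then read in terms of cohomology classes.
\<close>
lemma nat_copy_without_normal_lagrangian:
  assumes "group G" "finite (carrier G)" and c: "c \<in> carrier (Z2 G)"
    and nondeg: "nondegenerate_cocycle G c"
    and normal: "\<And>H. H \<lhd> G \<Longrightarrow> (card H)\<^sup>2 = order G \<Longrightarrow>
      \<exists>h\<in>H. \<exists>k\<in>H. h \<otimes>\<^bsub>G\<^esub> k = k \<otimes>\<^bsub>G\<^esub> h \<and> c (h, k) \<noteq> c (k, h)"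
  shows "\<exists>N :: nat monoid. group N \<and> order N = order G \<and>
    (\<exists>\<kappa> \<in> carrier (H2 N). nondegenerate N \<kappa> \<and> \<not> (\<exists>H. normal_lagrangian N \<kappa> H))"
proof -
  interpret group G by fact
  obtain e :: "'a \<Rightarrow> nat" where inj: "inj_on e (carrier G)"
    using finite_imp_inj_to_nat_seg[OF assms(2)] by blast
  define N where "N = image_group e G"
  define d where "d = inv_into (carrier G) e"
  have d_e [simp]: "d (e x) = x" if "x \<in> carrier G" for x
    using inj that by (simp add: d_def)
  have e_hom: "e \<in> iso G N"
    using inj by (auto simp: iso_def hom_def N_def image_group_def bij_betw_def)
  have gN: "group N"
    unfolding N_def using inj by (rule inj_imp_image_group_is_group)
  then have d_iso: "d \<in> iso N G"
    using iso_set_sym[OF e_hom] by (simp add: d_def)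
  have d_hom: "d (x \<otimes>\<^bsub>N\<^esub> y) = d x \<otimes>\<^bsub>G\<^esub> d y" if "x \<in> carrier N" "y \<in> carrier N" for x y
    using d_iso that by (simp add: iso_def hom_def)
  have bij: "bij_betw d (carrier N) (carrier G)" using d_iso by (simp add: iso_def)
  have d_closed [simp]: "d x \<in> carrier G" if "x \<in> carrier N" for x
    using bij that by (auto simp: bij_betw_def)
  have d_inj: "x = y" if "d x = d y" "x \<in> carrier N" "y \<in> carrier N" for x y
    using bij that by (auto simp: bij_betw_def inj_on_def)
  interpret N: group N by (rule gN)
  have d_one: "d \<one>\<^bsub>N\<^esub> = \<one>\<^bsub>G\<^esub>" by (simp add: N_def image_group_one)
  define c' where "c' = (\<lambda>(x, y)\<in>carrier N \<times> carrier N. c (d x, d y))"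
  have c': "c' \<in> carrier (Z2 N)"
    using c by (auto simp: Z2_def c'_def d_hom PiE_iff)
  have nd: "nondegenerate_cocycle N c'"
    unfolding nondegenerate_cocycle_def
  proof (intro ballI impI)
    fix x assume x: "x \<in> carrier N" "x \<noteq> \<one>\<^bsub>N\<^esub>"
    then have "d x \<noteq> \<one>\<^bsub>G\<^esub>" using d_inj[of x "\<one>\<^bsub>N\<^esub>"] d_one by auto
    then obtain g where g: "g \<in> carrier G" "g \<otimes>\<^bsub>G\<^esub> d x = d x \<otimes>\<^bsub>G\<^esub> g" "c (d x, g) \<noteq> c (g, d x)"
      using nondeg x by (auto simp: nondegenerate_cocycle_def centralizer_def)
    obtain y where y: "y \<in> carrier N" "g = d y" using g(1) bij by (auto simp: bij_betw_def)
    have "y \<otimes>\<^bsub>N\<^esub> x = x \<otimes>\<^bsub>N\<^esub> y" using g x y by (intro d_inj) (auto simp: d_hom)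
    then show "\<exists>y\<in>centralizer N x. c' (x, y) \<noteq> c' (y, x)"
      using g x y by (intro bexI[of _ y]) (auto simp: c'_def centralizer_def)
  qed
  have order: "order N = order G" using bij by (simp add: order_def bij_betw_same_card)
  have "\<not> normal_lagrangian N (cohomology_class N c') H" for H
  proof
    assume L: "normal_lagrangian N (cohomology_class N c') H"
    then have iso: "isotropic N (cohomology_class N c') H" and HN: "H \<lhd> N"
      and cardH: "real (card H) = sqrt (real (order N))"
      by (auto simp: normal_lagrangian_def lagrangian_def)
    interpret H: normal H N by (rule HN)
    have "(real (card H))\<^sup>2 = real (order N)" using cardH by simp
    then have "(card H)\<^sup>2 = order G"
      unfolding order by (metis of_nat_eq_iff of_nat_power)
    moreover have "card (d ` H) = card H"
      using bij H.subset by (intro card_image) (auto simp: bij_betw_def intro: inj_on_subset)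
    ultimately obtain h k where hk: "h \<in> H" "k \<in> H" "d h \<otimes>\<^bsub>G\<^esub> d k = d k \<otimes>\<^bsub>G\<^esub> d h"
      "c (d h, d k) \<noteq> c (d k, d h)"
      using normal[OF iso_normal_subgroup[OF d_iso gN assms(1) HN]] by auto
    have hkN: "h \<in> carrier N" "k \<in> carrier N" using hk H.subset by auto
    have "h \<otimes>\<^bsub>N\<^esub> k = k \<otimes>\<^bsub>N\<^esub> h" using hk hkN by (intro d_inj) (auto simp: d_hom)
    then have "c' (h, k) = c' (k, h)"
      using isotropic_cohomology_class_commute[OF gN c' iso] hk by blast
    then show False using hk hkN by (simp add: c'_def)
  qed
  moreover have "nondegenerate N (cohomology_class N c')"
    using nondegenerate_cohomology_class[OF gN c'] nd by blast
  moreover have "cohomology_class N c' \<in> carrier (H2 N)" using c' by (simp add: carrier_H2)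
  ultimately show ?thesis using gN order by blast
qed


section \<open>Vectors and matrices modulo p\<close>

definition root_of_unity :: "nat \<Rightarrow> int \<Rightarrow> complex" where
  "root_of_unity p z = cis (2 * pi * of_int z / of_nat p)"

lemma root_of_unity_nonzero [simp]: "root_of_unity p z \<noteq> 0"
  by (simp add: root_of_unity_def)

lemma root_of_unity_0 [simp]: "root_of_unity p 0 = 1"
  by (simp add: root_of_unity_def)

lemma root_of_unity_add: "root_of_unity p (x + y) = root_of_unity p x * root_of_unity p y"
  by (simp add: root_of_unity_def cis_mult ring_distribs add_divide_distrib)

lemma root_of_unity_eq_1_iff:
  assumes "p > 0" shows "root_of_unity p z = 1 \<longleftrightarrow> int p dvd z"
proof
  assume "root_of_unity p z = 1"
  then have "cos (2 * pi * of_int z / of_nat p) = 1"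
    by (simp add: root_of_unity_def complex_eq_iff)
  then obtain n :: int where "2 * pi * of_int z / of_nat p = n * 2 * pi"
    by (auto simp: cos_one_2pi_int)
  then have "real_of_int z = real_of_int (n * int p)" using assms by (simp add: field_simps)
  then show "int p dvd z" by (simp only: of_int_eq_iff) simp
next
  assume "int p dvd z"
  then obtain n where "z = int p * n" by auto
  then have "2 * pi * of_int z / of_nat p = 2 * pi * real_of_int n" using assms by simp
  then show "root_of_unity p z = 1" unfolding root_of_unity_def by simp
qed

lemma root_of_unity_eq_iff:
  assumes "p > 0" shows "root_of_unity p x = root_of_unity p y \<longleftrightarrow> x mod int p = y mod int p"
proof -
  have "root_of_unity p x = root_of_unity p (x - y) * root_of_unity p y"
    by (simp flip: root_of_unity_add)
  then show ?thesis by (simp add: root_of_unity_eq_1_iff[OF assms] mod_eq_dvd_iff)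
qed

definition vectors :: "nat \<Rightarrow> nat \<Rightarrow> (nat \<Rightarrow> int) monoid" where
  "vectors n p = product_group {..<n} (\<lambda>_. integer_mod_group p)"

definition mat_vec :: "nat \<Rightarrow> nat \<Rightarrow> (nat \<Rightarrow> nat \<Rightarrow> int) \<Rightarrow> (nat \<Rightarrow> int) \<Rightarrow> nat \<Rightarrow> int" where
  "mat_vec n p A v = (\<lambda>k\<in>{..<n}. (\<Sum>l<n. A k l * v l) mod int p)"

definition unit_vec :: "nat \<Rightarrow> nat \<Rightarrow> nat \<Rightarrow> int" where
  "unit_vec n t = (\<lambda>k\<in>{..<n}. if k = t then 1 else 0)"

lemma mem_vectors:
  "p > 0 \<Longrightarrow> v \<in> carrier (vectors n p) \<longleftrightarrow> v \<in> {..<n} \<rightarrow>\<^sub>E {0..<int p}"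
  by (simp add: vectors_def carrier_integer_mod_group)

lemma mult_vectors [simp]:
  "v \<otimes>\<^bsub>vectors n p\<^esub> w = (\<lambda>k\<in>{..<n}. (v k + w k) mod int p)"
  by (simp add: vectors_def)

lemma one_vectors [simp]: "\<one>\<^bsub>vectors n p\<^esub> = (\<lambda>k\<in>{..<n}. 0)"
  by (simp add: vectors_def)

lemma group_vectors: "group (vectors n p)"
  by (simp add: vectors_def)

lemma order_vectors: "p > 0 \<Longrightarrow> order (vectors n p) = p ^ n"
  by (simp add: order_def vectors_def carrier_integer_mod_group card_PiE)

lemma finite_vectors: "p > 0 \<Longrightarrow> finite (carrier (vectors n p))"
  by (auto simp: vectors_def carrier_integer_mod_group intro!: finite_PiE)

lemma unit_vec_closed: "p > 1 \<Longrightarrow> unit_vec n t \<in> carrier (vectors n p)"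
  by (auto simp: mem_vectors unit_vec_def)

lemma mat_vec_closed [simp]: "p > 0 \<Longrightarrow> mat_vec n p A v \<in> carrier (vectors n p)"
  by (auto simp: mem_vectors mat_vec_def)

lemma mod_sum_mult_eq:
  fixes a b :: "'a \<Rightarrow> int"
  shows "(\<Sum>l\<in>L. a l * (b l mod m)) mod m = (\<Sum>l\<in>L. a l * b l) mod m"
    and "(\<Sum>l\<in>L. (b l mod m) * a l) mod m = (\<Sum>l\<in>L. b l * a l) mod m"
  by (subst (1 2) mod_sum_eq[symmetric], simp add: mod_simps)+

lemma mat_vec_mult:
  "mat_vec n p A (v \<otimes>\<^bsub>vectors n p\<^esub> w) = mat_vec n p A v \<otimes>\<^bsub>vectors n p\<^esub> mat_vec n p A w"
  by (auto simp: mat_vec_def fun_eq_iff restrict_def mod_sum_mult_eq ring_distribs sum.distrib mod_simps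
      cong: if_cong)

lemma mat_vec_mat_vec:
  assumes "\<And>k l. k < n \<Longrightarrow> l < n \<Longrightarrow> [(\<Sum>m<n. A k m * A' m l) = C k l] (mod int p)"
  shows "mat_vec n p A (mat_vec n p A' v) = mat_vec n p C v"
proof
  fix k
  have "(\<Sum>m<n. A k m * ((\<Sum>l<n. A' m l * v l) mod int p)) mod int p = (\<Sum>l<n. C k l * v l) mod int p"
    if k: "k < n"
  proof -
    have "(\<Sum>m<n. A k m * (\<Sum>l<n. A' m l * v l)) = (\<Sum>l<n. (\<Sum>m<n. A k m * A' m l) * v l)"
      unfolding sum_distrib_left sum_distrib_right by (subst sum.swap) (simp only: mult_ac)
    moreover have "[(\<Sum>l<n. (\<Sum>m<n. A k m * A' m l) * v l) = (\<Sum>l<n. C k l * v l)] (mod int p)"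
      using assms k by (intro cong_sum cong_mult cong_refl) auto
    ultimately show ?thesis by (simp add: mod_sum_mult_eq cong_def)
  qed
  then show "mat_vec n p A (mat_vec n p A' v) k = mat_vec n p C v k"
    by (simp add: mat_vec_def)
qed

lemma mat_vec_identity:
  assumes "p > 0" "v \<in> carrier (vectors n p)"
  shows "mat_vec n p (\<lambda>k l. if k = l then 1 else 0) v = v"
proof
  fix k
  show "mat_vec n p (\<lambda>k l. if k = l then 1 else 0) v k = v k"
    using assms
    by (cases "k < n") (auto simp: mat_vec_def mem_vectors PiE_iff extensional_def if_distrib[of "\<lambda>x. x * _"] cong: if_cong)
qed

text \<open>
  The matrix applied to \<open>f\<close> is the transpose of \<open>A\<close>: moving it to the other side of the pairing
  gives \<open>A\<close>, which cancels \<open>C\<close>.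
\<close>
lemma mat_vec_pairing:
  assumes "\<And>l m. l < n \<Longrightarrow> m < n \<Longrightarrow> [(\<Sum>k<n. A l k * C k m) = (if l = m then 1 else 0)] (mod int p)"
  shows "[(\<Sum>k<n. mat_vec n p (\<lambda>k l. A l k) f k * mat_vec n p C v k) = (\<Sum>k<n. f k * v k)] (mod int p)"
proof -
  have "[(\<Sum>k<n. mat_vec n p (\<lambda>k l. A l k) f k * mat_vec n p C v k)
      = (\<Sum>k<n. (\<Sum>l<n. A l k * f l) * (\<Sum>m<n. C k m * v m))] (mod int p)"
    by (simp add: mat_vec_def mod_sum_mult_eq cong_def)
  also have "(\<Sum>k<n. (\<Sum>l<n. A l k * f l) * (\<Sum>m<n. C k m * v m))
      = (\<Sum>k<n. \<Sum>l<n. \<Sum>m<n. f l * ((A l k * C k m) * v m))"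
    by (simp add: sum_product mult_ac)
  also have "\<dots> = (\<Sum>l<n. \<Sum>k<n. \<Sum>m<n. f l * ((A l k * C k m) * v m))"
    by (rule sum.swap)
  also have "\<dots> = (\<Sum>l<n. f l * (\<Sum>m<n. (\<Sum>k<n. A l k * C k m) * v m))"
    unfolding sum_distrib_left sum_distrib_right by (subst (2) sum.swap) simp
  also have "[(\<Sum>l<n. f l * (\<Sum>m<n. (\<Sum>k<n. A l k * C k m) * v m))
      = (\<Sum>l<n. f l * (\<Sum>m<n. (if l = m then 1 else 0) * v m))] (mod int p)"
    using assms by (intro cong_sum cong_mult cong_refl) auto
  also have "(\<Sum>l<n. f l * (\<Sum>m<n. (if l = m then 1 else 0) * v m)) = (\<Sum>l<n. f l * v l)"
    by (simp add: if_distrib[of "\<lambda>x. x * _"] cong: if_cong)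
  finally show ?thesis .
qed


section \<open>The hyperbolic bicharacter and the plane\<close>

text \<open>
  A pair \<open>(v, f)\<close> is a vector with a linear form. The bicharacter evaluates \<open>f\<close> at \<open>w\<close>, so it is
  invariant under all of \<open>GL\<^sub>n\<close>, and its alternating form is the hyperbolic symplectic form.
\<close>
definition pairing :: "nat \<Rightarrow> nat \<Rightarrow> (nat \<Rightarrow> int) \<times> (nat \<Rightarrow> int) \<Rightarrow> (nat \<Rightarrow> int) \<times> (nat \<Rightarrow> int) \<Rightarrow> complex"
  where "pairing n p = (\<lambda>(v, f) (w, g). root_of_unity p (\<Sum>k<n. f k * w k))"

lemma sum_unit_vec:
  "t < n \<Longrightarrow> (\<Sum>k<n. f k * unit_vec n t k) = f t"
  "t < n \<Longrightarrow> (\<Sum>k<n. unit_vec n t k * f k) = f t"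
  by (simp_all add: unit_vec_def if_distrib[of "\<lambda>x. x * _"] if_distrib[of "\<lambda>x. _ * x"] cong: if_cong)

lemma comm_group_vectors: "comm_group (vectors n p)"
  by (rule group.group_comm_groupI[OF group_vectors]) (simp add: add.commute cong: restrict_cong)

lemma comm_group_DirProd:
  assumes "comm_group G" "comm_group H" shows "comm_group (G \<times>\<times> H)"
proof -
  interpret G: comm_group G by fact
  interpret H: comm_group H by fact
  show ?thesis
    by (rule group.group_comm_groupI[OF DirProd_group[OF G.is_group H.is_group]])
      (auto simp: G.m_comm H.m_comm)
qed

lemma nondegenerate_bicharacter_pairing:
  assumes p: "p > 1"
  shows "nondegenerate_bicharacter (vectors n p \<times>\<times> vectors n p) (pairing n p)"
proof -
  interpret comm_group "vectors n p \<times>\<times> vectors n p"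
    by (intro comm_group_DirProd comm_group_vectors)
  have p0: "p > 0" using p by simp
  show ?thesis
  proof
    show "finite (carrier (vectors n p \<times>\<times> vectors n p))"
      using finite_vectors[OF p0] by simp
  next
    show "pairing n p x y \<noteq> 0" for x y by (simp add: pairing_def split: prod.split)
  next
    fix x y z :: "(nat \<Rightarrow> int) \<times> (nat \<Rightarrow> int)"
    show "pairing n p (x \<otimes>\<^bsub>vectors n p \<times>\<times> vectors n p\<^esub> y) z = pairing n p x z * pairing n p y z"
      by (cases x; cases y; cases z)
        (simp add: pairing_def root_of_unity_eq_iff[OF p0] mod_sum_mult_eq ring_distribs sum.distrib
          flip: root_of_unity_add)
    show "pairing n p x (y \<otimes>\<^bsub>vectors n p \<times>\<times> vectors n p\<^esub> z) = pairing n p x y * pairing n p x z"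
      by (cases x; cases y; cases z)
        (simp add: pairing_def root_of_unity_eq_iff[OF p0] mod_sum_mult_eq ring_distribs sum.distrib
          flip: root_of_unity_add)
  next
    fix x assume x: "x \<in> carrier (vectors n p \<times>\<times> vectors n p)"
      and rad: "\<And>y. y \<in> carrier (vectors n p \<times>\<times> vectors n p) \<Longrightarrow> pairing n p x y = pairing n p y x"
    obtain v f where vf: "x = (v, f)" by (cases x)
    define z where "z = (\<lambda>k\<in>{..<n}. 0 :: int)"
    have z: "z \<in> carrier (vectors n p)" using p0 by (auto simp: z_def mem_vectors)
    have zs: "(\<Sum>k<n. h k * z k) = 0" "(\<Sum>k<n. z k * h k) = 0" for h by (simp_all add: z_def)
    have "f k = 0 \<and> v k = 0" if k: "k < n" for k
    proof -
      have "f k mod int p = 0"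
        using rad[of "(unit_vec n k, z)"] z unit_vec_closed[OF p] k
        by (simp add: vf pairing_def sum_unit_vec zs root_of_unity_eq_1_iff[OF p0] dvd_eq_mod_eq_0)
      moreover have "v k mod int p = 0"
        using rad[of "(z, unit_vec n k)"] z unit_vec_closed[OF p] k
        by (simp add: vf pairing_def sum_unit_vec zs root_of_unity_eq_1_iff[OF p0] dvd_eq_mod_eq_0)
      ultimately show ?thesis using x k by (auto simp: vf mem_vectors[OF p0] PiE_iff)
    qed
    then show "x = \<one>\<^bsub>vectors n p \<times>\<times> vectors n p\<^esub>"
      using x by (auto simp: vf mem_vectors[OF p0] fun_eq_iff PiE_iff extensional_def)
  qed
qed

abbreviation plane :: "nat \<Rightarrow> (int \<times> int) monoid" where
  "plane p \<equiv> integer_mod_group p \<times>\<times> integer_mod_group p"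

definition plane_form :: "nat \<Rightarrow> int \<times> int \<Rightarrow> int \<times> int \<Rightarrow> complex" where
  "plane_form p = (\<lambda>(i, j) (i', j'). root_of_unity p (i * j'))"

lemma nondegenerate_bicharacter_plane_form:
  assumes p: "p > 1"
  shows "nondegenerate_bicharacter (plane p) (plane_form p)"
proof -
  interpret comm_group "plane p"
    by (intro comm_group_DirProd abelian_integer_mod_group)
  have p0: "p > 0" using p by simp
  show ?thesis
  proof
    show "finite (carrier (plane p))"
      using p0 by (simp add: carrier_integer_mod_group)
  next
    show "plane_form p x y \<noteq> 0" for x y by (simp add: plane_form_def split: prod.split)
  next
    fix x y z :: "int \<times> int"
    show "plane_form p (x \<otimes>\<^bsub>plane p\<^esub> y) z = plane_form p x z * plane_form p y z"
      by (cases x; cases y; cases z)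
        (simp add: plane_form_def root_of_unity_eq_iff[OF p0] ring_distribs mod_simps
          flip: root_of_unity_add)
    show "plane_form p x (y \<otimes>\<^bsub>plane p\<^esub> z) = plane_form p x y * plane_form p x z"
      by (cases x; cases y; cases z)
        (simp add: plane_form_def root_of_unity_eq_iff[OF p0] ring_distribs mod_simps
          flip: root_of_unity_add)
  next
    fix x assume x: "x \<in> carrier (plane p)"
      and rad: "\<And>y. y \<in> carrier (plane p) \<Longrightarrow> plane_form p x y = plane_form p y x"
    obtain i j where ij: "x = (i, j)" by (cases x)
    have "i mod int p = 0"
      using rad[of "(0, 1)"] p by (simp add: ij plane_form_def root_of_unity_eq_1_iff[OF p0] dvd_eq_mod_eq_0)
    moreover have "j mod int p = 0"
      using rad[of "(1, 0)"] p by (simp add: ij plane_form_def root_of_unity_eq_1_iff[OF p0] dvd_eq_mod_eq_0)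
    ultimately show "x = \<one>\<^bsub>plane p\<^esub>"
      using x p0 by (auto simp: ij carrier_integer_mod_group)
  qed
qed

section \<open>A unipotent action of the plane\<close>

text \<open>
  The matrix of multiplication by \<open>exp (2ix + 2jy)\<close> in the ring of polynomials in \<open>x, y\<close> modulo
  \<open>xy, x\<^sup>3, y\<^sup>3\<close>, with respect to the basis \<open>1, x, y, x\<^sup>2, y\<^sup>2\<close>. The factor 2 makes the entries of the
  exponential integral.
\<close>
definition shear :: "int \<Rightarrow> int \<Rightarrow> nat \<Rightarrow> nat \<Rightarrow> int" where
  "shear i j k l =
     (if k = l then 1
      else if (k, l) \<in> {(1, 0), (3, 1)} then 2 * i
      else if (k, l) \<in> {(2, 0), (4, 2)} then 2 * j
      else if (k, l) = (3, 0) then 2 * i\<^sup>2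
      else if (k, l) = (4, 0) then 2 * j\<^sup>2
      else 0)"

lemma shear_0: "shear 0 0 = (\<lambda>k l. if k = l then 1 else 0)"
  by (auto simp: shear_def fun_eq_iff)

lemma shear_mult:
  assumes "k < 5" "l < 5"
  shows "(\<Sum>m<5. shear i j k m * shear i' j' m l) = shear (i + i') (j + j') k l"
proof -
  have sum5: "(\<Sum>m<5. f m) = f 0 + f 1 + f 2 + f 3 + f 4" for f :: "nat \<Rightarrow> int"
    by (simp add: eval_nat_numeral)
  have "k \<in> {0, 1, 2, 3, 4}" "l \<in> {0, 1, 2, 3, 4}" using assms by auto
  then show ?thesis
    unfolding sum5 by (elim insertE emptyE) (simp_all add: shear_def power2_sum algebra_simps)
qed

lemma shear_cong:
  assumes "[i = i'] (mod m)" "[j = j'] (mod m)"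
  shows "[shear i j k l = shear i' j' k l] (mod m)"
  using assms unfolding shear_def by (auto intro!: cong_mult cong_pow)

text \<open>On linear forms the action is the contragredient one: the transposed inverse matrix.\<close>
definition shear_act :: "nat \<Rightarrow> int \<times> int \<Rightarrow> (nat \<Rightarrow> int) \<times> (nat \<Rightarrow> int) \<Rightarrow> (nat \<Rightarrow> int) \<times> (nat \<Rightarrow> int)"
  where "shear_act p = (\<lambda>(i, j) (v, f).
    (mat_vec 5 p (shear i j) v, mat_vec 5 p (\<lambda>k l. shear (-i) (-j) l k) f))"

lemma symplectic_action_shear_act:
  assumes p: "p > 1"
  shows "symplectic_action (plane p) (plane_form p) (vectors 5 p \<times>\<times> vectors 5 p) (pairing 5 p) (shear_act p)"
proof -
  interpret Q: nondegenerate_bicharacter "plane p" "plane_form p"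
    using p by (rule nondegenerate_bicharacter_plane_form)
  interpret M: nondegenerate_bicharacter "vectors 5 p \<times>\<times> vectors 5 p" "pairing 5 p"
    using p by (rule nondegenerate_bicharacter_pairing)
  have p0: "p > 0" using p by simp
  show ?thesis
  proof
    show "shear_act p q x \<in> carrier (vectors 5 p \<times>\<times> vectors 5 p)" for q x
      using p0 by (cases q; cases x) (simp add: shear_act_def)
  next
    fix q :: "int \<times> int" and x y :: "(nat \<Rightarrow> int) \<times> (nat \<Rightarrow> int)"
    show "shear_act p q (x \<otimes>\<^bsub>vectors 5 p \<times>\<times> vectors 5 p\<^esub> y) =
        shear_act p q x \<otimes>\<^bsub>vectors 5 p \<times>\<times> vectors 5 p\<^esub> shear_act p q y"
      by (cases q; cases x; cases y) (simp add: shear_act_def mat_vec_mult del: mult_vectors)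
  next
    fix q r :: "int \<times> int" and x :: "(nat \<Rightarrow> int) \<times> (nat \<Rightarrow> int)"
    obtain i j i' j' v f where eqs: "q = (i, j)" "r = (i', j')" "x = (v, f)"
      by (cases q; cases r; cases x)
    have "mat_vec 5 p (shear i j) (mat_vec 5 p (shear i' j') v) =
        mat_vec 5 p (shear ((i + i') mod int p) ((j + j') mod int p)) v"
      by (rule mat_vec_mat_vec, subst shear_mult, assumption, assumption, rule shear_cong)
        (simp_all add: cong_def)
    moreover have "mat_vec 5 p (\<lambda>k l. shear (-i) (-j) l k) (mat_vec 5 p (\<lambda>k l. shear (-i') (-j') l k) f) =
        mat_vec 5 p (\<lambda>k l. shear (- ((i + i') mod int p)) (- ((j + j') mod int p)) l k) f"
      by (rule mat_vec_mat_vec, subst mult.commute, subst shear_mult, assumption, assumption,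
          rule shear_cong) (simp_all add: cong_def mod_minus_eq minus_diff_commute)
    ultimately show "shear_act p q (shear_act p r x) = shear_act p (q \<otimes>\<^bsub>plane p\<^esub> r) x"
      by (simp add: shear_act_def eqs)
  next
    fix x assume "x \<in> carrier (vectors 5 p \<times>\<times> vectors 5 p)"
    then show "shear_act p \<one>\<^bsub>plane p\<^esub> x = x"
      using p0 mat_vec_identity[OF p0]
      by (cases x) (auto simp: shear_act_def shear_0 eq_commute[of "_ :: nat"])
  next
    fix q :: "int \<times> int" and x y :: "(nat \<Rightarrow> int) \<times> (nat \<Rightarrow> int)"
    obtain i j v f w g where eqs: "q = (i, j)" "x = (v, f)" "y = (w, g)"
      by (cases q; cases x; cases y)
    have "[(\<Sum>k<5. mat_vec 5 p (\<lambda>k l. shear (-i) (-j) l k) f k * mat_vec 5 p (shear i j) w k)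
        = (\<Sum>k<5. f k * w k)] (mod int p)"
      by (rule mat_vec_pairing) (simp add: shear_mult shear_0)
    then show "pairing 5 p (shear_act p q x) (shear_act p q y) = pairing 5 p x y"
      by (simp add: pairing_def shear_act_def eqs root_of_unity_eq_iff[OF p0] cong_def)
  qed
qed

text \<open>
  With \<open>N = 2ix + 2jy\<close>, the coefficients of \<open>x\<^sup>2\<close> and \<open>y\<^sup>2\<close> in \<open>N\<^sup>2\<close> are \<open>4i\<^sup>2\<close> and \<open>4j\<^sup>2\<close>. If \<open>a\<close> is whichever of
  \<open>i, j\<close> is nonzero, then pairing \<open>q - 1\<close> applied to the unit vector of \<open>1\<close> with \<open>q - 1\<close> applied to
  the coordinate form of that square gives \<open>-4a\<^sup>2\<close>, which is nonzero modulo an odd prime.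
\<close>
lemma shear_displacement_anisotropic:
  assumes "Factorial_Ring.prime p" "p > 2" and q: "q \<in> carrier (plane p)" "q \<noteq> \<one>\<^bsub>plane p\<^esub>"
  defines "B \<equiv> pairing 5 p" and "d \<equiv> symplectic_action.displacement (vectors 5 p \<times>\<times> vectors 5 p) (shear_act p) q"
  shows "\<exists>x\<in>carrier (vectors 5 p \<times>\<times> vectors 5 p). \<exists>y\<in>carrier (vectors 5 p \<times>\<times> vectors 5 p).
    B (d x) (d y) \<noteq> B (d y) (d x)"
proof -
  have p: "p > 0" "p > 1" using assms(2) by auto
  interpret S: symplectic_action "plane p" "plane_form p" "vectors 5 p \<times>\<times> vectors 5 p" "pairing 5 p" "shear_act p"
    using p(2) by (rule symplectic_action_shear_act)
  obtain i j where ij: "q = (i, j)" by (cases q)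
  then have i: "0 \<le> i" "i < int p" and j: "0 \<le> j" "j < int p"
    using q p by (auto simp: carrier_integer_mod_group)
  have "i \<noteq> 0 \<or> j \<noteq> 0" using q ij by auto
  then obtain t :: nat and a where t: "t = 3 \<and> a = i \<or> t = 4 \<and> a = j" and a0: "a \<noteq> 0" by blast
  have t': "t < 5" "t \<noteq> 0" "shear i j t 0 = 2 * a\<^sup>2" "shear (-i) (-j) t 0 = 2 * a\<^sup>2"
    using t by (auto simp: shear_def)
  have "\<not> int p dvd a" using t a0 i j by (auto dest: zdvd_imp_le)
  moreover have "\<not> int p dvd 4"
  proof
    assume "int p dvd 4"
    then have "int p dvd int (2 ^ 2)" by simp
    then have "p dvd 2 ^ 2" by (simp only: int_dvd_int_iff)
    then show False using assms(1,2) by (metis prime_dvd_power dvd_imp_le not_le pos2)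
  qed
  ultimately have ndvd: "\<not> int p dvd 4 * a\<^sup>2"
    using assms(1) by (simp add: prime_dvd_mult_iff prime_dvd_power_iff)
  define z where "z = (\<lambda>k\<in>{..<5::nat}. 0 :: int)"
  have z: "z \<in> carrier (vectors 5 p)" using p by (auto simp: z_def mem_vectors)
  have zs: "(\<Sum>k<5. h k * z k) = 0" "(\<Sum>k<5. z k * h k) = 0" for h by (simp_all add: z_def)
  have mz: "mat_vec 5 p A z = z" for A by (simp add: mat_vec_def zs) (simp add: z_def)
  define x y where "x = (unit_vec 5 0, z)" and "y = (z, unit_vec 5 t)"
  have xy: "x \<in> carrier (vectors 5 p \<times>\<times> vectors 5 p)" "y \<in> carrier (vectors 5 p \<times>\<times> vectors 5 p)"
    using z unit_vec_closed[OF p(2)] by (auto simp: x_def y_def)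
  have "B (d x) (d y) = 1"
    unfolding B_def d_def S.B_displacement[OF q(1) xy]
    by (simp add: x_def y_def ij shear_act_def pairing_def mz zs)
  moreover have "pairing 5 p (shear_act p q y) x = root_of_unity p (2 * a\<^sup>2)"
    using t' p by (simp add: x_def y_def ij shear_act_def pairing_def sum_unit_vec root_of_unity_eq_iff mat_vec_def)
  moreover have "pairing 5 p y (shear_act p q x) = root_of_unity p (2 * a\<^sup>2)"
    using t' p by (simp add: x_def y_def ij shear_act_def pairing_def sum_unit_vec root_of_unity_eq_iff mat_vec_def)
  moreover have "pairing 5 p y x = 1"
    using t' by (simp add: x_def y_def pairing_def sum_unit_vec) (simp add: unit_vec_def)
  ultimately have "B (d x) (d y) = 1" "B (d y) (d x) = 1 / root_of_unity p (4 * a\<^sup>2)"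
    unfolding B_def d_def S.B_displacement[OF q(1) xy(2,1)] by (auto simp flip: root_of_unity_add)
  then show ?thesis using ndvd xy p by (force simp: root_of_unity_eq_1_iff)
qed

section \<open>A class without normal Lagrangians\<close>

theorem proposition1p11:
  fixes p :: nat
  assumes "Factorial_Ring.prime p" and "p \<ge> 5"
  shows "\<exists>G :: nat monoid. group G \<and> order G = p ^ 12 \<and>
           (\<exists>\<kappa> \<in> carrier (H2 G). nondegenerate G \<kappa> \<and> \<not> (\<exists>H. normal_lagrangian G \<kappa> H))"
proof -
  have p: "p > 0" "p > 1" "p > 2" using assms(2) by auto
  interpret S: symplectic_action "plane p" "plane_form p" "vectors 5 p \<times>\<times> vectors 5 p" "pairing 5 p" "shear_act p"
    using p(2) by (rule symplectic_action_shear_act)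
  have oQ: "order (plane p) = p ^ 2"
    using p by (simp add: order_def carrier_integer_mod_group card_cartesian_product power2_eq_square)
  have "card (carrier (vectors 5 p)) = p ^ 5" using order_vectors[OF p(1)] by (simp add: order_def)
  then have order: "order S.semidirect = p ^ 12"
    using oQ by (simp add: order_def card_cartesian_product flip: power_add)
  have "1 < order (plane p)" using one_less_power[OF p(2), of 2] unfolding oQ by simp
  then have "\<exists>N :: nat monoid. group N \<and> order N = order S.semidirect \<and>
    (\<exists>\<kappa> \<in> carrier (H2 N). nondegenerate N \<kappa> \<and> \<not> (\<exists>H. normal_lagrangian N \<kappa> H))"
    using S.Q.finite_carrier S.M.finite_carrier
    by (intro nat_copy_without_normal_lagrangian[OF S.group_semidirect _ S.cocycle_in_Z2
          S.nondegenerate_cocycle] S.asymmetric_pair_in_normal_subgroup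
        shear_displacement_anisotropic[OF assms(1) p(3)]) auto
  then show ?thesis unfolding order .
qed

end
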